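(* Let $G$ be a connected graph of order at least $3$. Then $msd_{\gamma_{t2}}(G)\leq 3$.
   Context: All graphs are finite and simple. For a graph $G$ without isolated vertices, a set $S\subseteq V(G)$ is a semitotal dominating set if every vertex of $V(G)\setminus S$ has a neighbor in $S$ and every vertex of $S$ is at distance at most $2$ from some other vertex of $S$. The semitotal domination number $\gamma_{t2}(G)$ is the minimum cardinality of a semitotal dominating set of $G$. Subdividing an edge $uv$ $k$ times means replacing it by a path $u w_1 w_2\cdots w_k v$ with $k$ new internal vertices. The semitotal domination multisubdivision number $msd_{\gamma_{t2}}(G)$ is the minimum positive integer $k$ such that there exists an edge of $G$ whose subdivision $k$ times yields a graph with semitotal domination number larger than $\gamma_{t2}(G)$ (i.e., the minimum over all edges $e$ of the least $k\ge 1$ such that subdividing $e$ $k$ times increases $\gamma_{t2}$). *)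

theory Defs
  imports
    "Graph_Theory.Digraph_Component"
    "Graph_Theory.Vertex_Walk"
    "Graph_Theory.Shortest_Path"
begin

text \<open>
  Finite simple graphs are rendered by \<^locale>\<open>pair_graph\<close>: finite, symmetric, loop-free, and
  without parallel arcs. An undirected edge is the pair of its two opposite arcs.
\<close>

definition graph_dist :: "'a pair_pre_digraph \<Rightarrow> 'a \<Rightarrow> 'a \<Rightarrow> ereal" where
  "graph_dist G u v = wf_digraph.\<mu> (with_proj G) (\<lambda>_. 1) u v"

definition semitotal_dominating_set :: "'a pair_pre_digraph \<Rightarrow> 'a set \<Rightarrow> bool" where
  "semitotal_dominating_set G S \<longleftrightarrow>
     S \<subseteq> pverts G \<and>
     (\<forall>v \<in> pverts G - S. \<exists>u \<in> S. (v, u) \<in> parcs G) \<and>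
     (\<forall>v \<in> S. \<exists>u \<in> S. u \<noteq> v \<and> graph_dist G v u \<le> 2)"

text \<open>Meaningful for finite graphs without isolated vertices, where the whole vertex set qualifies.\<close>

definition semitotal_domination_number :: "'a pair_pre_digraph \<Rightarrow> nat" where
  "semitotal_domination_number G = (LEAST n. \<exists>S. semitotal_dominating_set G S \<and> card S = n)"

text \<open>
  The vertex type is enlarged to a disjoint sum, because the type of the given graph need not
  contain enough fresh vertices: old vertices are tagged \<^const>\<open>Inl\<close>, and the new internal
  vertices are \<^term>\<open>Inr 0\<close>, \dots, \<^term>\<open>Inr (k - 1)\<close>, in the order from \<open>u\<close> to \<open>v\<close>.
\<close>

definition subdivide_times ::
    "'a pair_pre_digraph \<Rightarrow> 'a \<times> 'a \<Rightarrow> nat \<Rightarrow> ('a + nat) pair_pre_digraph" where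
  "subdivide_times G e k = (case e of (u, v) \<Rightarrow>
     let P = set (vwalk_arcs (Inl u # map Inr [0..<k] @ [Inl v]))
     in \<lparr> pverts = Inl ` pverts G \<union> Inr ` {..<k},
          parcs = map_prod Inl Inl ` (parcs G - {(u, v), (v, u)}) \<union> P \<union> P\<inverse> \<rparr>)"

text \<open>
  The infimum is taken in \<^typ>\<open>enat\<close>, so that it is \<open>\<infinity>\<close> (and not some finite default) if no
  multiple subdivision of an edge increases the semitotal domination number.
\<close>

definition semitotal_msd :: "'a pair_pre_digraph \<Rightarrow> enat" where
  "semitotal_msd G = (INF k \<in> {k. 1 \<le> k \<and> (\<exists>e \<in> parcs G.
     semitotal_domination_number G < semitotal_domination_number (subdivide_times G e k))}. enat k)"

end

theory Submission
  imports Defs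
begin

text \<open>
  Subdividing any edge \<open>uv\<close> three times increases \<open>\<gamma>\<^sub>t\<^sub>2\<close>. Let \<open>S'\<close> be semitotal dominating after
  the subdivision, \<open>W\<close> its set of new vertices and \<open>S\<^sub>0\<close> its set of old vertices; \<open>W\<close> is nonempty
  because the middle new vertex is dominated. If \<open>W\<close> is a singleton, then \<open>S\<^sub>0\<close> itself is semitotal
  dominating in \<open>G\<close>. If \<open>W\<close> has at least two elements and \<open>S\<^sub>0\<close> meets \<open>{u, v}\<close>, then
  \<open>S\<^sub>0 \<union> {u, v}\<close> is. Otherwise, since \<open>G\<close> is connected of order at least 3, one end \<open>a\<close> of the edge
  has a neighbour \<open>y\<close> outside \<open>{u, v}\<close>, and \<open>S\<^sub>0 \<union> {a}\<close> is semitotal dominating: \<open>y\<close> belongs to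
  \<open>S\<^sub>0\<close> or has a neighbour in it, which provides the partner of \<open>a\<close>.
\<close>

section \<open>Distance at most two in terms of arcs\<close>

text \<open>A relational form of the distance bound, meant for distinct vertices: a round trip
  \<open>x\<close>, \<open>w\<close>, \<open>x\<close> also satisfies it, so distinctness is always
  stated beside it.\<close>

definition within_two :: "'a rel \<Rightarrow> 'a \<Rightarrow> 'a \<Rightarrow> bool" where
  "within_two E x y \<longleftrightarrow> (x, y) \<in> E \<or> (\<exists>w. (x, w) \<in> E \<and> (w, y) \<in> E)"

context pair_wf_digraph
begin

lemma awalk_cost_one: "awalk_cost (\<lambda>_. 1) p = real (length p)"
  by (induction p) simp_all

lemma graph_dist_le_two_iff:
  assumes "x \<noteq> y"
  shows "graph_dist G x y \<le> 2 \<longleftrightarrow> within_two (parcs G) x y"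
proof
  assume "graph_dist G x y \<le> 2"
  \<comment> \<open>The distance is an infimum over walks; the strict bound by 3 yields an actual
    walk below it, and integrality of its length gives at most two arcs.\<close>
  also have "(2 :: ereal) < 3"
    by simp
  finally obtain p where p: "awalk x p y" "ereal (awalk_cost (\<lambda>_. 1) p) < 3"
    by (auto simp: graph_dist_def \<mu>_def INF_less_iff)
  then have len: "length p \<le> 2"
    by (simp add: awalk_cost_one)
  show "within_two (parcs G) x y"
  proof (cases p)
    case Nil
    then show ?thesis using p assms by (simp add: awalk_Nil_iff)
  next
    case p_eq: (Cons e es)
    show ?thesis
    proof (cases es)
      case Nil
      then show ?thesis
        using p p_eq by (auto simp: awalk_simps within_two_def)
    next
      case (Cons f fs)
      then show ?thesis
        using p p_eq len by (cases e; cases f) (auto simp: awalk_simps within_two_def)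
    qed
  qed
next
  have *: "graph_dist G x y \<le> 2" if "awalk x p y" "length p \<le> 2" for p
  proof -
    have "graph_dist G x y \<le> ereal (awalk_cost (\<lambda>_. 1) p)"
      unfolding graph_dist_def using that(1) by (rule min_cost_le_walk_cost)
    also have "\<dots> \<le> 2"
      using that(2) by (simp add: awalk_cost_one)
    finally show ?thesis .
  qed
  assume "within_two (parcs G) x y"
  then consider "(x, y) \<in> parcs G" | w where "(x, w) \<in> parcs G" "(w, y) \<in> parcs G"
    by (auto simp: within_two_def)
  then show "graph_dist G x y \<le> 2"
  proof cases
    case 1
    then show ?thesis by (intro *[of "[(x, y)]"]) (auto simp: awalk_simps dest: in_arcsD2)
  next
    case 2
    then show ?thesis
      by (intro *[of "[(x, w), (w, y)]"]) (auto simp: awalk_simps dest: in_arcsD2)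
  qed
qed

lemma semitotal_dominating_set_iff:
  "semitotal_dominating_set G S \<longleftrightarrow>
     S \<subseteq> pverts G \<and>
     (\<forall>x \<in> pverts G - S. \<exists>y \<in> S. (x, y) \<in> parcs G) \<and>
     (\<forall>x \<in> S. \<exists>y \<in> S. y \<noteq> x \<and> within_two (parcs G) x y)"
  unfolding semitotal_dominating_set_def 
  by (intro conj_cong ball_cong bex_cong refl) (erule graph_dist_le_two_iff[OF not_sym])

end

lemma subdivide_three_times:
  "pverts (subdivide_times G (u, v) 3) = Inl ` pverts G \<union> {Inr 0, Inr 1, Inr 2}"
  "parcs (subdivide_times G (u, v) 3) =
     map_prod Inl Inl ` (parcs G - {(u, v), (v, u)}) \<union>
     {(Inl u, Inr 0), (Inr 0, Inr 1), (Inr 1, Inr 2), (Inr 2, Inl v),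
      (Inr 0, Inl u), (Inr 1, Inr 0), (Inr 2, Inr 1), (Inl v, Inr 2)}"
  by (auto simp: subdivide_times_def upt_rec lessThan_nat_numeral)

section \<open>From the subdivided graph to smaller sets in \<open>G\<close>\<close>

context pair_graph
begin

lemma parcs_sym: "(x, y) \<in> parcs G \<Longrightarrow> (y, x) \<in> parcs G"
  using arcs_ends_symmetric[OF pair_sym_arcs, of x y] by simp

text \<open>Follow a walk from \<open>x\<close> to \<open>y\<close>: some arc of it steps out of
  \<open>U\<close>. Since the arcs are symmetric, reachability in the symmetric closure is
  reachability in \<open>G\<close>.\<close>

lemma exists_arc_leaving:
  assumes "Digraph_Component.connected (with_proj G)"
    and "x \<in> U" "x \<in> pverts G" "y \<notin> U" "y \<in> pverts G"
  obtains a b where "a \<in> U" "b \<notin> U" "(a, b) \<in> parcs G"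
proof -
  have "x \<rightarrow>\<^sup>*\<^bsub>mk_symmetric (with_proj G)\<^esub> y"
    using assms by (auto simp: connected_def)
  then have "x \<rightarrow>\<^sup>*\<^bsub>with_proj G\<^esub> y"
    by (simp only: reachable_mk_symmetric_eq[OF pair_sym_arcs])
  then have "\<exists>a b. a \<in> U \<and> b \<notin> U \<and> (a, b) \<in> parcs G"
    using \<open>x \<in> U\<close> \<open>y \<notin> U\<close>
    by (induction rule: reachable_induct) auto
  then show ?thesis using that by blast
qed

text \<open>
  The sets \<open>S\<close> and \<open>W\<close> are the old and the new vertices of a semitotal dominating set of the
  subdivided graph. The hypotheses record what its two defining conditions say about \<open>G\<close>.
\<close>

lemma smaller_semitotal_dominating_set:
  assumes edge: "(u, v) \<in> parcs G"
    and y: "(a, y) \<in> parcs G" "a \<in> {u, v}" "y \<notin> {u, v}"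
    and S: "S \<subseteq> pverts G"
    and W: "W \<subseteq> {0, 1, 2 :: nat}"
    and dom: "\<And>x. x \<in> pverts G \<Longrightarrow> x \<notin> S \<Longrightarrow>
      (\<exists>s \<in> S. (x, s) \<in> parcs G - {(u, v), (v, u)}) \<or> x = u \<and> 0 \<in> W \<or> x = v \<and> 2 \<in> W"
    and domW: "0 \<in> W \<or> 1 \<in> W \<or> u \<in> S" "0 \<in> W \<or> 1 \<in> W \<or> 2 \<in> W" "1 \<in> W \<or> 2 \<in> W \<or> v \<in> S"
    and partner: "\<And>x. x \<in> S \<Longrightarrow>
      (\<exists>t \<in> S. t \<noteq> x \<and> within_two (parcs G) x t) \<or>
      x = u \<and> (0 \<in> W \<or> 1 \<in> W) \<or> x = v \<and> (1 \<in> W \<or> 2 \<in> W) \<or>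
      (x, u) \<in> parcs G - {(v, u)} \<and> 0 \<in> W \<or> (x, v) \<in> parcs G - {(u, v)} \<and> 2 \<in> W"
  obtains T where "semitotal_dominating_set G T" "card T < card S + card W"
proof -
  have uv: "u \<in> pverts G" "v \<in> pverts G" "u \<noteq> v" "(v, u) \<in> parcs G"
    using edge parcs_sym by (auto dest: in_arcsD1 in_arcsD2 pair_no_loops)
  have fin: "finite S" "finite W"
    using S W pair_finite_verts finite_subset by blast+
  consider (zero) "W = {0}" | (one) "W = {1}" | (two) "W = {2}" | (more) "card W \<ge> 2"
  proof (cases "card W \<ge> 2")
    case False
    moreover have "card W \<noteq> 0" using domW(2) fin by auto
    ultimately have "card W = 1" by linarith
    then obtain i where "W = {i}" by (auto simp: card_1_singleton_iff)
    then show ?thesis using W that by auto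
  qed
  then show ?thesis
  proof cases
    case zero
    \<comment> \<open>The new vertex 2 can only be dominated by \<open>v\<close>. In
      \<open>G\<close>, \<open>v\<close> then dominates \<open>u\<close> and serves as partner in
      place of the new vertex 0.\<close>
    then have "v \<in> S" using domW by auto
    have "semitotal_dominating_set G S"
      unfolding semitotal_dominating_set_iff
    proof (intro conjI ballI)
      fix x assume "x \<in> pverts G - S"
      then show "\<exists>s \<in> S. (x, s) \<in> parcs G"
        using dom[of x] zero \<open>v \<in> S\<close> edge by auto
    next
      fix x assume x: "x \<in> S"
      show "\<exists>t \<in> S. t \<noteq> x \<and> within_two (parcs G) x t"
      proof (cases "\<exists>t \<in> S. t \<noteq> x \<and> within_two (parcs G) x t")
        case False
        then have "x = u \<or> (x, u) \<in> parcs G - {(v, u)}"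
          using partner[OF x] zero by auto
        \<comment> \<open>Either \<open>x = u\<close>, or \<open>x\<close> is a neighbour of
          \<open>u\<close> other than \<open>v\<close> and the path through \<open>u\<close> reaches
          \<open>v\<close>.\<close>
        then have "v \<noteq> x" "within_two (parcs G) x v"
          using edge uv unfolding within_two_def by blast+
        then show ?thesis using \<open>v \<in> S\<close> by blast
      qed blast
    qed (use S in auto)
    then show ?thesis using zero that by simp
  next
    case two
    then have "u \<in> S" using domW by auto
    have "semitotal_dominating_set G S"
      unfolding semitotal_dominating_set_iff
    proof (intro conjI ballI)
      fix x assume "x \<in> pverts G - S"
      then show "\<exists>s \<in> S. (x, s) \<in> parcs G"
        using dom[of x] two \<open>u \<in> S\<close> uv by auto
    next
      fix x assume x: "x \<in> S"
      show "\<exists>t \<in> S. t \<noteq> x \<and> within_two (parcs G) x t"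
      proof (cases "\<exists>t \<in> S. t \<noteq> x \<and> within_two (parcs G) x t")
        case False
        then have "x = v \<or> (x, v) \<in> parcs G - {(u, v)}"
          using partner[OF x] two by auto
        then have "u \<noteq> x" "within_two (parcs G) x u"
          using edge uv unfolding within_two_def by blast+
        then show ?thesis using \<open>u \<in> S\<close> by blast
      qed blast
    qed (use S in auto)
    then show ?thesis using two that by simp
  next
    case one
    have "semitotal_dominating_set G S"
      unfolding semitotal_dominating_set_iff
    proof (intro conjI ballI)
      fix x assume "x \<in> pverts G - S"
      then show "\<exists>s \<in> S. (x, s) \<in> parcs G"
        using dom[of x] one by auto
    next
      fix x assume x: "x \<in> S"
      \<comment> \<open>The new vertex 1 does not dominate \<open>v\<close>. So \<open>v\<close> is
        in \<open>S\<close>, or it has a neighbour in \<open>S\<close> other than \<open>u\<close>,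
        at most two steps from \<open>u\<close> via \<open>v\<close>.\<close>
      have u: "\<exists>t \<in> S. t \<noteq> u \<and> within_two (parcs G) u t"
        using dom[of v] one edge uv unfolding within_two_def by (cases "v \<in> S") auto
      have v: "\<exists>t \<in> S. t \<noteq> v \<and> within_two (parcs G) v t"
        using dom[of u] one edge uv unfolding within_two_def by (cases "u \<in> S") auto
      show "\<exists>t \<in> S. t \<noteq> x \<and> within_two (parcs G) x t"
        using partner[OF x] one u v by auto
    qed (use S in auto)
    then show ?thesis using one that by simp
  next
    case more
    \<comment> \<open>The edge \<open>uv\<close>, restored in \<open>G\<close>, brings everything
      equal or adjacent to one end within two of both ends.\<close>
    have near: "within_two (parcs G) x a"
      if "x = u \<or> x = v \<or> (x, u) \<in> parcs G \<or> (x, v) \<in> parcs G" "x \<noteq> a" "a \<in> {u, v}" for x a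
      using that edge uv unfolding within_two_def by auto
    show ?thesis
    proof (cases "u \<in> S \<or> v \<in> S")
      case True
      \<comment> \<open>One end is already in \<open>S\<close>, so this adds at most one vertex,
        while \<open>W\<close> has at least two.\<close>
      let ?T = "S \<union> {u, v}"
      have "semitotal_dominating_set G ?T"
        unfolding semitotal_dominating_set_iff
      proof (intro conjI ballI)
        fix x assume "x \<in> pverts G - ?T"
        then show "\<exists>s \<in> ?T. (x, s) \<in> parcs G"
          using dom[of x] by auto
      next
        fix x assume x: "x \<in> ?T"
        show "\<exists>t \<in> ?T. t \<noteq> x \<and> within_two (parcs G) x t"
        proof (cases "\<exists>t \<in> S. t \<noteq> x \<and> within_two (parcs G) x t")
          case False
          then have "x = u \<or> x = v \<or> (x, u) \<in> parcs G \<or> (x, v) \<in> parcs G"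
            using partner[of x] x by auto
          then show ?thesis
            using near[of x u] near[of x v] uv(3) by (cases "x = u") simp_all
        qed blast
      qed (use S uv in auto)
      moreover have "card ?T \<le> Suc (card S)"
        using True fin by (auto simp: insert_absorb card_insert_if)
      ultimately show ?thesis using more that by force
    next
      case False
      let ?T = "insert a S"
      have "\<exists>z \<in> S. within_two (parcs G) a z"
      proof (cases "y \<in> S")
        case True
        then show ?thesis using y unfolding within_two_def by auto
      next
        case False
        \<comment> \<open>As \<open>y\<close> lies outside \<open>{u, v}\<close>, it must be
          dominated by an old vertex, which \<open>a\<close> reaches through
          \<open>y\<close>.\<close>
        then show ?thesis
          using dom[of y] y in_arcsD2[OF y(1)] unfolding within_two_def by blast
      qed
      then obtain z where z: "z \<in> S" "within_two (parcs G) a z" by blast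
      have "semitotal_dominating_set G ?T"
        unfolding semitotal_dominating_set_iff
      proof (intro conjI ballI)
        fix x assume "x \<in> pverts G - ?T"
        \<comment> \<open>If \<open>x\<close> was dominated by a new vertex, it is the end other
          than \<open>a\<close>, and \<open>a\<close> now dominates it.\<close>
        then show "\<exists>s \<in> ?T. (x, s) \<in> parcs G"
          using dom[of x] edge uv y(2) by auto
      next
        fix x assume x: "x \<in> ?T"
        show "\<exists>t \<in> ?T. t \<noteq> x \<and> within_two (parcs G) x t"
        proof (cases "x = a")
          case True
          then show ?thesis using z y(2) False by (intro bexI[of _ z]) auto
        next
          case x_neq: False
          show ?thesis
          proof (cases "\<exists>t \<in> S. t \<noteq> x \<and> within_two (parcs G) x t")
            case False
            then have "x = u \<or> x = v \<or> (x, u) \<in> parcs G \<or> (x, v) \<in> parcs G"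
              using partner[of x] x x_neq by auto
            then have "within_two (parcs G) x a"
              using x_neq y(2) by (rule near)
            then show ?thesis
              using x_neq by (intro bexI[of _ a]) simp_all
          qed blast
        qed
      qed (use S uv y in auto)
      moreover have "card ?T \<le> Suc (card S)"
        using fin by (simp add: card_insert_if)
      ultimately show ?thesis using more that by force
    qed
  qed
qed

lemma pair_wf_digraph_subdivide_three_times:
  assumes "(u, v) \<in> parcs G"
  shows "pair_wf_digraph (subdivide_times G (u, v) 3)"
  using assms by unfold_locales (auto simp: subdivide_three_times dest: in_arcsD1 in_arcsD2)

lemma subdivide_three_times_smaller_set:
  assumes edge: "(u, v) \<in> parcs G"
    and y: "(a, y) \<in> parcs G" "a \<in> {u, v}" "y \<notin> {u, v}"
    and S': "semitotal_dominating_set (subdivide_times G (u, v) 3) S'"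
  obtains T where "semitotal_dominating_set G T" "card T < card S'"
proof -
  let ?H = "subdivide_times G (u, v) 3"
  interpret H: pair_wf_digraph ?H
    using edge by (rule pair_wf_digraph_subdivide_three_times)
  define S where "S = Inl -` S'"
  define W where "W = Inr -` S'"
  have sub: "S' \<subseteq> pverts ?H"
    and dom: "\<And>x. x \<in> pverts ?H \<Longrightarrow> x \<notin> S' \<Longrightarrow> \<exists>y \<in> S'. (x, y) \<in> parcs ?H"
    and partner: "\<And>x. x \<in> S' \<Longrightarrow> \<exists>y \<in> S'. y \<noteq> x \<and> within_two (parcs ?H) x y"
    using S' unfolding H.semitotal_dominating_set_iff by auto
  have S: "S \<subseteq> pverts G" and W: "W \<subseteq> {0, 1, 2}"
    using sub by (auto simp: S_def W_def subdivide_three_times)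
  have fin: "finite S" "finite W"
    using S W pair_finite_verts finite_subset by blast+
  have "x \<in> S' \<longleftrightarrow> x \<in> S <+> W" for x
    by (cases x) (auto simp: S_def W_def)
  then have "S' = S <+> W"
    by blast
  then have card: "card S' = card S + card W"
    using fin by (simp add: card_Plus)
  have S_iff: "Inl x \<in> S' \<longleftrightarrow> x \<in> S" and W_iff: "Inr i \<in> S' \<longleftrightarrow> i \<in> W" for x i
    by (simp_all add: S_def W_def)
  show ?thesis
  proof (rule smaller_semitotal_dominating_set[OF edge y S W])
    fix x assume "x \<in> pverts G" "x \<notin> S"
    then obtain s where "s \<in> S'" "(Inl x, s) \<in> parcs ?H"
      using dom[of "Inl x"] by (auto simp: S_iff subdivide_three_times)
    then show "(\<exists>s \<in> S. (x, s) \<in> parcs G - {(u, v), (v, u)}) \<or> x = u \<and> 0 \<in> W \<or> x = v \<and> 2 \<in> W"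
      by (auto simp: subdivide_three_times S_iff W_iff)
  next
    show "0 \<in> W \<or> 1 \<in> W \<or> u \<in> S"
      using dom[of "Inr 0"] by (cases "0 \<in> W") (auto simp: subdivide_three_times S_iff W_iff)
    show "0 \<in> W \<or> 1 \<in> W \<or> 2 \<in> W"
      using dom[of "Inr 1"] by (cases "1 \<in> W") (auto simp: subdivide_three_times S_iff W_iff)
    show "1 \<in> W \<or> 2 \<in> W \<or> v \<in> S"
      using dom[of "Inr 2"] by (cases "2 \<in> W") (auto simp: subdivide_three_times S_iff W_iff)
  next
    fix x assume "x \<in> S"
    then obtain t where "t \<in> S'" "t \<noteq> Inl x" "within_two (parcs ?H) (Inl x) t"
      using partner[of "Inl x"] by (auto simp: S_iff)
    then show "(\<exists>t \<in> S. t \<noteq> x \<and> within_two (parcs G) x t) \<or>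
        x = u \<and> (0 \<in> W \<or> 1 \<in> W) \<or> x = v \<and> (1 \<in> W \<or> 2 \<in> W) \<or>
        (x, u) \<in> parcs G - {(v, u)} \<and> 0 \<in> W \<or> (x, v) \<in> parcs G - {(u, v)} \<and> 2 \<in> W"
      \<comment> \<open>The path replacing \<open>uv\<close> has four arcs, too long to be crossed
        in two steps: a walk to an old \<open>t\<close> stays in \<open>G\<close>, and a walk to a
        new \<open>t\<close> gives one of the other alternatives.\<close>
      by (auto simp: within_two_def subdivide_three_times S_iff W_iff)
  qed (use card that in auto)
qed

section \<open>Comparison of the semitotal domination numbers\<close>

lemma semitotal_domination_number_subdivide_three_times:
  assumes conn: "Digraph_Component.connected (with_proj G)"
    and card: "card (pverts G) \<ge> 3"
    and edge: "(u, v) \<in> parcs G"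
  shows "semitotal_domination_number G < semitotal_domination_number (subdivide_times G (u, v) 3)"
proof -
  let ?H = "subdivide_times G (u, v) 3"
  interpret H: pair_wf_digraph ?H
    using edge by (rule pair_wf_digraph_subdivide_three_times)
  have uv: "u \<in> pverts G" "v \<in> pverts G" "u \<noteq> v"
    using edge by (auto dest: in_arcsD1 in_arcsD2 pair_no_loops)
  have "\<not> pverts G \<subseteq> {u, v}"
    using card card_mono[of "{u, v}" "pverts G"] uv by auto
  then obtain a y where y: "(a, y) \<in> parcs G" "a \<in> {u, v}" "y \<notin> {u, v}"
    using exists_arc_leaving[OF conn, of u "{u, v}"] uv by blast
  \<comment> \<open>Without isolated vertices the whole vertex set of \<open>?H\<close> is semitotal
    dominating, so the \<open>LEAST\<close> defining its number is attained. Vertices outside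
    \<open>{u, v}\<close> keep all their arcs; the others lie on the new path.\<close>
  have nbr: "\<exists>y \<in> pverts ?H. y \<noteq> x \<and> (x, y) \<in> parcs ?H" if "x \<in> pverts ?H" for x
  proof (cases "x \<in> Inl ` (pverts G - {u, v})")
    case True
    then obtain z where z: "x = Inl z" "z \<in> pverts G" "z \<notin> {u, v}" by auto
    then obtain b where "(z, b) \<in> parcs G" "b \<noteq> z"
      using exists_arc_leaving[OF conn, of z "{z}" u] uv by auto
    then show ?thesis
      using z by (intro bexI[of _ "Inl b"]) (auto simp: subdivide_three_times dest: in_arcsD2)
  next
    case False
    then show ?thesis
      using that by (auto simp: subdivide_three_times)
  qed
  then have "semitotal_dominating_set ?H (pverts ?H)"
    unfolding H.semitotal_dominating_set_iff within_two_def by blast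
  then have "\<exists>n S. semitotal_dominating_set ?H S \<and> card S = n"
    by blast
  then obtain S' where S': "semitotal_dominating_set ?H S'" "card S' = semitotal_domination_number ?H"
    unfolding semitotal_domination_number_def
    using LeastI_ex[of "\<lambda>n. \<exists>S. semitotal_dominating_set ?H S \<and> card S = n"] by blast
  obtain T where T: "semitotal_dominating_set G T" "card T < card S'"
    using subdivide_three_times_smaller_set[OF edge y S'(1)] .
  have "semitotal_domination_number G \<le> card T"
    unfolding semitotal_domination_number_def using T(1) by (blast intro: Least_le)
  then show ?thesis
    using T(2) S'(2) by simp
qed

end

theorem theorem2p4:
  fixes G :: "'a pair_pre_digraph"
  assumes "pair_graph G"
    and "Digraph_Component.connected (with_proj G)"
    and "card (pverts G) \<ge> 3"
  shows "semitotal_msd G \<le> 3"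
proof -
  interpret pair_graph G by fact
  have "pverts G \<noteq> {}"
    using assms(3) by auto
  then obtain x where x: "x \<in> pverts G" by blast
  have "\<not> pverts G \<subseteq> {x}"
    using assms(3) card_mono[of "{x}" "pverts G"] by auto
  \<comment> \<open>Any edge will do: it puts 3 into the set whose infimum is
    \<open>semitotal_msd G\<close>.\<close>
  then obtain e where e: "e \<in> parcs G"
    using exists_arc_leaving[OF assms(2), of x "{x}"] x by blast
  then have "semitotal_domination_number G < semitotal_domination_number (subdivide_times G e 3)"
    using semitotal_domination_number_subdivide_three_times[OF assms(2,3)] by (cases e) auto
  with e have "semitotal_msd G \<le> enat 3"
    unfolding semitotal_msd_def by (intro INF_lower) auto
  then show ?thesis by (simp add: numeral_eq_enat)
qed

end
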